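(* Let $X$ be a real Hilbert space with inner product $(\cdot,\cdot)_X$ and induced norm $\|\cdot\|_X$, and let $\mathsf{b}(\cdot,\cdot): X\times X\to\mathbb{R}$ be a bounded bilinear form, so that there exists $M>0$ such that $|\mathsf{b}(v,u)|\leq M\|u\|_X\|v\|_X$ for all $u,v\in X$. Suppose that $\mathsf{b}$ further satisfies $$\beta\,\|u\|_X^2\leq |\mathsf{b}(u,u)|\qquad\text{for all } u\in X,$$ for some $\beta>0$. Let $X_h\subset X$ be a finite-dimensional subspace with $\dim(X_h)=N$ and $X_h=\mathrm{span}\{q_i\}_{i=1}^N$. Then the matrix $\mathbf{B}_h\in\mathbb{R}^{N\times N}$ defined by $(\mathbf{B}_h)_{ij}=\mathsf{b}(q_j,q_i)$ satisfies $$\kappa(\mathbf{B}_h)\leq\frac{M}{\beta}\,(\kappa(\mathcal{Q}))^2,$$ where $\mathcal{Q}=[q_1,\ldots,q_N]$ is the quasimatrix whose columns are $q_1,\ldots,q_N$.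
   Context: For a square matrix $\mathbf{A}$, $\kappa(\mathbf{A})=\|\mathbf{A}\|_2\|\mathbf{A}^{-1}\|_2$ denotes the 2-norm condition number. A quasimatrix $\mathcal{Q}=[q_1,\ldots,q_N]$ is a "matrix" whose columns $q_i$ are elements (functions) of the Hilbert space $X$. It has a QR factorization $\mathcal{Q}=\tilde{\mathcal{Q}}R$, where $\tilde{\mathcal{Q}}$ has columns that are orthonormal with respect to $(\cdot,\cdot)_X$ and $R\in\mathbb{R}^{N\times N}$ is upper triangular. The condition number of the quasimatrix is defined as $\kappa(\mathcal{Q})=\kappa(R)$, the matrix condition number of $R$. *)

theory Defs
  imports "HOL-Analysis.Analysis"
begin

text \<open>The norm on \<^typ>\<open>real^'n\<close> is Euclidean, so \<^const>\<open>onorm\<close> is the matrix 2-norm.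
  For singular \<open>A\<close> the term \<^term>\<open>matrix_inv A\<close> is an unspecified matrix, so the value below
  is meaningful only for invertible \<open>A\<close>.\<close>

definition matrix_cond :: "real^'n^'n \<Rightarrow> real"
  where "matrix_cond A = onorm ((*v) A) * onorm ((*v) (matrix_inv A))"

text \<open>A quasimatrix with columns in \<open>'a\<close> is the family \<open>q\<close> of its columns. The index type carries
  a linear order so that ``upper triangular'' makes sense; the last conjunct is the
  column-wise reading of \<open>q = Q R\<close>.\<close>

definition quasimatrix_QR ::
    "('n::{finite,linorder} \<Rightarrow> 'a::real_inner) \<Rightarrow> ('n \<Rightarrow> 'a) \<Rightarrow>
      real^('n::{finite,linorder})^('n::{finite,linorder}) \<Rightarrow> bool"
  where "quasimatrix_QR q Q R \<longleftrightarrow>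
    (\<forall>i j. inner (Q i) (Q j) = (if i = j then 1 else 0)) \<and>
    (\<forall>i j. j < i \<longrightarrow> R $ i $ j = 0) \<and>
    (\<forall>j. q j = (\<Sum>i\<in>UNIV. (R $ i $ j) *\<^sub>R Q i))"

text \<open>The choice of factorization does not matter, see \<open>quasimatrix_cond_eq\<close> below.\<close>

definition quasimatrix_cond :: "('n::{finite,linorder} \<Rightarrow> 'a::real_inner) \<Rightarrow> real"
  where "quasimatrix_cond q = matrix_cond (SOME R. \<exists>Q. quasimatrix_QR q Q R)"

lemma quasimatrix_QR_norm:
  fixes q :: "'b::{finite,linorder} \<Rightarrow> 'a::real_inner"
  assumes "quasimatrix_QR q Q R"
  shows "norm (R *v x) = norm (\<Sum>j\<in>UNIV. (x $ j) *\<^sub>R q j)"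
proof -
  have orth: "inner (Q i) (Q j) = (if i = j then 1 else 0)" for i j
    using assms unfolding quasimatrix_QR_def by blast
  have q: "q j = (\<Sum>i\<in>UNIV. (R $ i $ j) *\<^sub>R Q i)" for j
    using assms unfolding quasimatrix_QR_def by blast
  have "(\<Sum>j\<in>UNIV. (x $ j) *\<^sub>R q j) = (\<Sum>j\<in>UNIV. \<Sum>i\<in>UNIV. (x $ j * R $ i $ j) *\<^sub>R Q i)"
    by (subst q) (simp add: scaleR_sum_right)
  also have "\<dots> = (\<Sum>i\<in>UNIV. \<Sum>j\<in>UNIV. (x $ j * R $ i $ j) *\<^sub>R Q i)"
    by (rule sum.swap)
  also have "\<dots> = (\<Sum>i\<in>UNIV. ((R *v x) $ i) *\<^sub>R Q i)"
    by (simp add: matrix_vector_mult_def scaleR_sum_left mult.commute)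
  finally have e: "(\<Sum>j\<in>UNIV. (x $ j) *\<^sub>R q j) = (\<Sum>i\<in>UNIV. ((R *v x) $ i) *\<^sub>R Q i)" .
  have "inner (\<Sum>i\<in>UNIV. (y $ i) *\<^sub>R Q i) (\<Sum>i\<in>UNIV. (y $ i) *\<^sub>R Q i) = inner y y" for y :: "real^('b::{finite,linorder})"
    by (simp add: inner_sum_left inner_sum_right orth inner_vec_def if_distrib sum.delta cong: if_cong)
  then show ?thesis
    unfolding e norm_eq_sqrt_inner by simp
qed

lemma onorm_matrix_inv:
  fixes R :: "real^'n^'n"
  assumes "invertible R"
  shows "onorm ((*v) (matrix_inv R)) = (SUP x. norm x / norm (R *v x))"
proof -
  have inv: "R ** matrix_inv R = mat 1 \<and> matrix_inv R ** R = mat 1"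
    using assms unfolding invertible_def matrix_inv_def by (rule someI_ex)
  have 1: "matrix_inv R *v (R *v x) = x" "R *v (matrix_inv R *v x) = x" for x
    using inv by (simp_all add: matrix_vector_mul_assoc)
  have "range (\<lambda>y. norm (matrix_inv R *v y) / norm y) = range (\<lambda>x. norm x / norm (R *v x))"
  proof safe
    fix y
    have "norm (matrix_inv R *v y) / norm y
        = norm (matrix_inv R *v y) / norm (R *v (matrix_inv R *v y))"
      by (simp add: 1)
    then show "norm (matrix_inv R *v y) / norm y \<in> range (\<lambda>x. norm x / norm (R *v x))"
      by (rule range_eqI)
  next
    fix x
    have "norm x / norm (R *v x) = norm (matrix_inv R *v (R *v x)) / norm (R *v x)"
      by (simp add: 1)
    then show "norm x / norm (R *v x) \<in> range (\<lambda>y. norm (matrix_inv R *v y) / norm y)"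
      by (rule range_eqI)
  qed
  then show ?thesis
    unfolding onorm_def by simp
qed

lemma invertible_iff_norm:
  fixes R :: "real^'n^'n"
  shows "invertible R \<longleftrightarrow> (\<forall>x. norm (R *v x) = 0 \<longrightarrow> x = 0)"
  by (simp add: invertible_left_inverse matrix_left_invertible_ker)

lemma matrix_cond_cong:
  fixes R S :: "real^'n^'n"
  assumes "\<And>x. norm (R *v x) = norm (S *v x)"
  shows "matrix_cond R = matrix_cond S"
proof (cases "invertible R")
  case True
  then have "invertible S"
    by (simp add: invertible_iff_norm assms)
  with True show ?thesis
    by (simp add: matrix_cond_def onorm_matrix_inv assms) (simp add: onorm_def assms)
next
  case False
  then have "\<not> invertible S"
    by (simp add: invertible_iff_norm assms)
  with False have "matrix_inv R = matrix_inv S"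
    unfolding matrix_inv_def invertible_def by (metis (no_types, lifting))
  then show ?thesis
    by (simp add: matrix_cond_def onorm_def assms)
qed

lemma quasimatrix_cond_eq:
  assumes "quasimatrix_QR q Q R"
  shows "quasimatrix_cond q = matrix_cond R"
proof -
  let ?S = "SOME R. \<exists>Q. quasimatrix_QR q Q R"
  obtain Q' where "quasimatrix_QR q Q' ?S"
    using someI_ex[of "\<lambda>R. \<exists>Q. quasimatrix_QR q Q R"] assms by blast
  then show ?thesis
    unfolding quasimatrix_cond_def using assms
    by (intro matrix_cond_cong) (simp add: quasimatrix_QR_norm)
qed

lemma quasimatrix_QR_exists:
  fixes q :: "'n::{finite,linorder} \<Rightarrow> 'a::real_inner"
  assumes "inj q" "independent (range q)"
  shows "\<exists>Q R. quasimatrix_QR q Q R"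
proof -
  have "\<exists>(e::'n \<Rightarrow> 'a) (r::'n \<Rightarrow> 'n \<Rightarrow> real).
      (\<forall>i\<in>A. \<forall>j\<in>A. inner (e i) (e j) = (if i = j then 1 else 0)) \<and>
      (\<forall>i\<in>A. e i \<in> span (q ` A)) \<and> (\<forall>i j. j < i \<longrightarrow> r i j = 0) \<and>
      (\<forall>j\<in>A. q j = (\<Sum>i\<in>A. r i j *\<^sub>R e i))" for A :: "'n set"
  proof (induction A rule: finite_linorder_max_induct[OF finite])
    case 1
    show ?case by (auto intro!: exI[of _ "\<lambda>_ _. 0"])
  next
    case (2 k A)
    from "2.IH" obtain e :: "'n \<Rightarrow> 'a" and r :: "'n \<Rightarrow> 'n \<Rightarrow> real" where
      *: "(\<forall>i\<in>A. \<forall>j\<in>A. inner (e i) (e j) = (if i = j then 1 else 0)) \<and>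
      (\<forall>i\<in>A. e i \<in> span (q ` A)) \<and> (\<forall>i j. j < i \<longrightarrow> r i j = 0) \<and>
      (\<forall>j\<in>A. q j = (\<Sum>i\<in>A. r i j *\<^sub>R e i))"
      by (elim exE)
    have orth: "inner (e i) (e j) = (if i = j then 1 else 0)" if "i \<in> A" "j \<in> A" for i j
      using * that by blast
    have sp: "e i \<in> span (q ` A)" if "i \<in> A" for i
      using * that by blast
    have tri: "r i j = 0" if "j < i" for i j
      using * that by blast
    have q: "q j = (\<Sum>i\<in>A. r i j *\<^sub>R e i)" if "j \<in> A" for j
      using * that by blast
    have fin: "finite A" and kA: "k \<notin> A" and lt: "\<And>i. i \<in> A \<Longrightarrow> i < k"
      using 2 by auto
    define p where "p = (\<Sum>i\<in>A. inner (q k) (e i) *\<^sub>R e i)"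
    define w where "w = q k - p"
    have p: "p \<in> span (q ` A)"
      unfolding p_def by (intro span_sum span_scale sp)
    have "q k \<notin> span (q ` A)"
    proof
      assume "q k \<in> span (q ` A)"
      moreover have "q ` A \<subseteq> range q - {q k}"
        using kA \<open>inj q\<close> by (auto dest: injD)
      ultimately have "q k \<in> span (range q - {q k})"
        using span_mono by blast
      then show False
        using assms(2) unfolding dependent_def by blast
    qed
    with p have w0: "w \<noteq> 0"
      by (auto simp: w_def)
    have pe: "inner p (e i) = inner (q k) (e i)" if "i \<in> A" for i
      using that fin
      by (simp add: p_def inner_sum_left orth if_distrib sum.delta cong: if_cong)
    have we: "inner w (e i) = 0" if "i \<in> A" for i
      using pe[OF that] by (simp add: w_def inner_diff_left)
    define e' where "e' = e(k := w /\<^sub>R norm w)"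
    define r' where "r' i j = (if j = k then (if i = k then norm w else if i \<in> A then inner (q k) (e i) else 0)
        else if i = k then 0 else r i j)" for i j
    have e'A: "e' i = e i" if "i \<in> A" for i
      using that kA by (auto simp: e'_def)
    have e'k: "e' k = w /\<^sub>R norm w"
      by (simp add: e'_def)
    have "inner (e' i) (e' j) = (if i = j then 1 else 0)" if "i \<in> insert k A" "j \<in> insert k A" for i j
    proof -
      have "norm (e i) = 1" if "i \<in> A" for i
        using orth[OF that that] by (simp add: norm_eq_sqrt_inner)
      then show ?thesis
        using that kA w0
        by (auto simp: e'A e'k orth we inner_commute[of "e _" w] dot_square_norm power2_eq_square)
    qed
    moreover have "e' i \<in> span (q ` insert k A)" if "i \<in> insert k A" for i
    proof -
      have m: "span (q ` A) \<subseteq> span (q ` insert k A)"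
        by (intro span_mono) auto
      have "w \<in> span (q ` insert k A)"
        unfolding w_def using p m by (intro span_diff) (auto intro: span_base)
      then show ?thesis
        using that m sp by (auto simp: e'A e'k span_scale)
    qed
    moreover have "r' i j = 0" if "j < i" for i j
      using that tri lt by (auto simp: r'_def dest: less_asym)
    moreover have "q j = (\<Sum>i\<in>insert k A. r' i j *\<^sub>R e' i)" if "j \<in> insert k A" for j
    proof (cases "j = k")
      case True
      have "(\<Sum>i\<in>A. r' i k *\<^sub>R e' i) = p"
        unfolding p_def using kA by (intro sum.cong) (auto simp: r'_def e'A)
      then show ?thesis
        using True fin kA w0 by (simp add: e'k r'_def[of k k]) (simp add: w_def)
    next
      case False
      then have "(\<Sum>i\<in>A. r' i j *\<^sub>R e' i) = (\<Sum>i\<in>A. r i j *\<^sub>R e i)"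
        using kA by (intro sum.cong) (auto simp: r'_def e'A)
      then show ?thesis
        using False that fin kA q[of j] by (simp add: r'_def[of k j])
    qed
    ultimately show ?case
      by blast
  qed
  from this[of UNIV] obtain e :: "'n \<Rightarrow> 'a" and r :: "'n \<Rightarrow> 'n \<Rightarrow> real" where
    "\<forall>i j. inner (e i) (e j) = (if i = j then 1 else 0)" "\<forall>i j. j < i \<longrightarrow> r i j = 0"
    "\<forall>j. q j = (\<Sum>i\<in>UNIV. r i j *\<^sub>R e i)"
    by auto
  then have "quasimatrix_QR q e (\<chi> i j. r i j)"
    unfolding quasimatrix_QR_def by simp
  then show ?thesis by blast
qed

lemma quasimatrix_QR_invertible:
  fixes q :: "'n::{finite,linorder} \<Rightarrow> 'a::real_inner"
  assumes "inj q" "independent (range q)" "quasimatrix_QR q Q R"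
  shows "invertible R"
  unfolding invertible_iff_norm
proof (intro allI impI)
  fix x :: "real^('n::{finite,linorder})"
  assume "norm (R *v x) = 0"
  then have "(\<Sum>j\<in>UNIV. (x $ j) *\<^sub>R q j) = 0"
    using quasimatrix_QR_norm[OF assms(3)] by simp
  then have "(\<Sum>v\<in>range q. (x $ inv q v) *\<^sub>R v) = 0"
    using assms(1) by (simp add: sum.reindex)
  then have "x $ inv q (q j) = 0" for j
    using independentD[OF assms(2), of "range q" "\<lambda>v. x $ inv q v" "q j"] by simp
  then show "x = 0"
    using assms(1) by (simp add: vec_eq_iff)
qed

end

theory Submission
  imports Defs
begin

text \<open>
  Let \<open>S x = (\<Sum>j. x\<^sub>j q\<^sub>j)\<close> be the element of \<open>X\<^sub>h\<close> with coordinates \<open>x\<close>. The matrix \<open>B\<close> represents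
  \<open>b\<close> in these coordinates: \<open>y \<bullet> B x = b (S x) (S y)\<close> (\<open>inner_Galerkin_matrix\<close>). So the bounds on
  \<open>b\<close>, which are expressed in the norm of the Hilbert space, turn into Euclidean bounds on \<open>B\<close> as
  soon as \<open>\<parallel>S x\<parallel>\<close> is compared with \<open>\<parallel>x\<parallel>\<close>. A QR factorization of \<open>q\<close> does this exactly, since its
  orthonormal factor preserves norms: \<open>\<parallel>S x\<parallel> = \<parallel>R x\<parallel>\<close>. Hence
  \<open>\<parallel>x\<parallel> / \<parallel>R\<^sup>-\<^sup>1\<parallel> \<le> \<parallel>S x\<parallel> \<le> \<parallel>R\<parallel> \<parallel>x\<parallel>\<close>.

  Boundedness of \<open>b\<close>, tested with \<open>y = B x\<close>, gives \<open>\<parallel>B\<parallel> \<le> M \<parallel>R\<parallel>\<^sup>2\<close> (\<open>onorm_Galerkin_matrix_le\<close>).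
  Coercivity, tested with \<open>y = x\<close>, gives \<open>\<beta> \<parallel>x\<parallel> \<le> \<parallel>R\<^sup>-\<^sup>1\<parallel>\<^sup>2 \<parallel>B x\<parallel>\<close>
  (\<open>Galerkin_matrix_lower_bound\<close>), and a matrix that is bounded below is invertible, with the
  reciprocal of that bound controlling its inverse. The two estimates multiply to
  \<open>(M / \<beta>) (\<parallel>R\<parallel> \<parallel>R\<^sup>-\<^sup>1\<parallel>)\<^sup>2\<close>. The dimension hypothesis makes \<open>q\<close> a basis, which
  provides the QR factorization with invertible \<open>R\<close>.
\<close>

text \<open>Any basis of the span extracted from the family already needs \<open>CARD('n)\<close> members, so nothing
  can be discarded: neither a repeated vector nor a dependent one.\<close>

lemma spanning_family_is_basis:
  fixes q :: "'n::finite \<Rightarrow> 'a::real_vector"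
  assumes "dim (span (range q)) = CARD('n)"
  shows "inj q" and "independent (range q)"
proof -
  obtain B where B: "B \<subseteq> range q" "independent B" "card B = dim (range q)"
    using basis_exists[of "range q"] by metis
  have "card B = CARD('n)"
    using B(3) assms by (simp add: dim_span)
  moreover have "card B \<le> card (range q)"
    using B(1) by (intro card_mono) auto
  moreover have "card (range q) \<le> CARD('n)"
    by (rule card_image_le) simp
  ultimately have card: "card (range q) = CARD('n)" "card B = card (range q)"
    by auto
  show "inj q"
    using card(1) by (intro eq_card_imp_inj_on) auto
  have "B = range q"
    using B(1) card(2) by (intro card_subset_eq) auto
  with B(2) show "independent (range q)"
    by simp
qed

lemma invertible_if_bounded_below:
  fixes A :: "real^'n^'n"
  assumes "c > 0" and "\<And>x. c * norm x \<le> norm (A *v x)"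
  shows "invertible A" and "onorm ((*v) (matrix_inv A)) \<le> 1 / c"
proof -
  show inv: "invertible A"
    unfolding invertible_iff_norm
  proof (intro allI impI)
    fix x :: "real^'n"
    assume "norm (A *v x) = 0"
    with assms(2)[of x] \<open>c > 0\<close> show "x = 0"
      by (simp add: mult_le_0_iff)
  qed
  have "norm x / norm (A *v x) \<le> 1 / c" for x
  proof (cases "norm (A *v x) = 0")
    case True
    \<comment> \<open>The quotient is \<open>0\<close> by the convention for division by zero.\<close>
    then show ?thesis using \<open>c > 0\<close> by simp
  next
    case False
    then have "norm (A *v x) > 0" by simp
    with assms(2)[of x] \<open>c > 0\<close> show ?thesis
      by (simp add: divide_le_eq le_divide_eq mult.commute)
  qed
  then show "onorm ((*v) (matrix_inv A)) \<le> 1 / c"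
    unfolding onorm_matrix_inv[OF inv] by (intro cSUP_least) auto
qed

lemma norm_matrix_vector_le: "norm (A *v x) \<le> onorm ((*v) A) * norm x"
  for A :: "real^'n^'m"
  by (rule onorm[OF matrix_vector_mul_bounded_linear])

lemma norm_le_onorm_matrix_inv:
  fixes R :: "real^'n^'n"
  assumes "invertible R"
  shows "norm x \<le> onorm ((*v) (matrix_inv R)) * norm (R *v x)"
proof -
  have "matrix_inv R ** R = mat 1"
    using assms unfolding invertible_def matrix_inv_def by (rule someI_ex[THEN conjunct2])
  then have "x = matrix_inv R *v (R *v x)"
    by (simp add: matrix_vector_mul_assoc)
  then show ?thesis
    using norm_matrix_vector_le[of "matrix_inv R" "R *v x"] by simp
qed

text \<open>The index order matters: trial functions run over the columns, so \<open>x\<close> enters the first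
  argument of \<open>b\<close>.\<close>

lemma inner_Galerkin_matrix:
  fixes b :: "'a::real_vector \<Rightarrow> 'a \<Rightarrow> real" and q :: "'n::finite \<Rightarrow> 'a"
  assumes "bilinear b"
  shows "inner y ((\<chi> i j. b (q j) (q i)) *v x)
    = b (\<Sum>j\<in>UNIV. (x $ j) *\<^sub>R q j) (\<Sum>i\<in>UNIV. (y $ i) *\<^sub>R q i)"
proof -
  have "b (\<Sum>j\<in>UNIV. (x $ j) *\<^sub>R q j) (\<Sum>i\<in>UNIV. (y $ i) *\<^sub>R q i)
      = (\<Sum>(j, i)\<in>UNIV \<times> UNIV. x $ j * (y $ i * b (q j) (q i)))"
    by (simp add: bilinear_sum[OF assms] bilinear_lmul[OF assms] bilinear_rmul[OF assms]
        case_prod_unfold mult.left_commute)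
  also have "\<dots> = (\<Sum>j\<in>UNIV. \<Sum>i\<in>UNIV. x $ j * (y $ i * b (q j) (q i)))"
    by (simp only: sum.cartesian_product)
  also have "\<dots> = (\<Sum>i\<in>UNIV. \<Sum>j\<in>UNIV. x $ j * (y $ i * b (q j) (q i)))"
    by (rule sum.swap)
  also have "\<dots> = inner y ((\<chi> i j. b (q j) (q i)) *v x)"
    by (simp add: inner_vec_def matrix_vector_mult_def sum_distrib_left mult_ac)
  finally show ?thesis ..
qed

text \<open>Testing against \<open>y = B x\<close> turns \<open>\<bar>y \<bullet> B x\<bar>\<close> into \<open>\<parallel>B x\<parallel>\<^sup>2\<close>. Each of the two arguments of \<open>b\<close> passes
  through \<open>R\<close> once, which is where the square comes from.\<close>

lemma onorm_Galerkin_matrix_le: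
  fixes b :: "'a::real_inner \<Rightarrow> 'a \<Rightarrow> real" and q :: "'n::{finite,linorder} \<Rightarrow> 'a"
  assumes "bilinear b" and "M \<ge> 0" and bound: "\<And>u v. \<bar>b v u\<bar> \<le> M * norm u * norm v"
    and QR: "quasimatrix_QR q Q R"
  shows "onorm ((*v) (\<chi> i j. b (q j) (q i))) \<le> M * (onorm ((*v) R))\<^sup>2"
proof (rule onorm_le)
  fix x :: "real^('n::{finite,linorder})"
  define y where "y = (\<chi> i j. b (q j) (q i)) *v x"
  let ?r = "onorm ((*v) R)"
  have "norm y * norm y = inner y y"
    by (simp add: dot_square_norm power2_eq_square)
  also have "\<dots> = b (\<Sum>j\<in>UNIV. (x $ j) *\<^sub>R q j) (\<Sum>i\<in>UNIV. (y $ i) *\<^sub>R q i)"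
    using inner_Galerkin_matrix[OF assms(1), of y q x] by (simp flip: y_def)
  also have "\<dots> \<le> M * norm (R *v y) * norm (R *v x)"
    using bound unfolding quasimatrix_QR_norm[OF QR] by (rule order_trans[OF abs_ge_self])
  also have "\<dots> \<le> M * (?r * norm y) * (?r * norm x)"
    using \<open>M \<ge> 0\<close> by (intro mult_mono norm_matrix_vector_le mult_nonneg_nonneg
        onorm_pos_le matrix_vector_mul_bounded_linear order_refl) auto
  finally have "norm y * norm y \<le> norm y * (M * ?r\<^sup>2 * norm x)"
    by (simp add: power2_eq_square mult_ac)
  then show "norm y \<le> M * ?r\<^sup>2 * norm x"
    using \<open>M \<ge> 0\<close> by (cases "y = 0") auto
qed

text \<open>Testing against \<open>y = x\<close> brings in coercivity, and the Cauchy-Schwarz inequality bounds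
  \<open>\<bar>x \<bullet> B x\<bar>\<close> by \<open>\<parallel>x\<parallel> \<parallel>B x\<parallel>\<close>, from which one factor \<open>\<parallel>x\<parallel>\<close> cancels.\<close>

lemma Galerkin_matrix_lower_bound:
  fixes b :: "'a::real_inner \<Rightarrow> 'a \<Rightarrow> real" and q :: "'n::{finite,linorder} \<Rightarrow> 'a"
  assumes "bilinear b" and "\<beta> \<ge> 0" and coercive: "\<And>u. \<beta> * (norm u)\<^sup>2 \<le> \<bar>b u u\<bar>"
    and QR: "quasimatrix_QR q Q R" and inv: "invertible R"
  shows "\<beta> * norm x
    \<le> (onorm ((*v) (matrix_inv R)))\<^sup>2 * norm ((\<chi> i j. b (q j) (q i)) *v x)"
proof -
  define y where "y = (\<chi> i j. b (q j) (q i)) *v x"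
  let ?s = "onorm ((*v) (matrix_inv R))"
  have "\<beta> * (norm (R *v x))\<^sup>2 \<le> \<bar>inner x y\<bar>"
    using coercive unfolding y_def inner_Galerkin_matrix[OF assms(1)] quasimatrix_QR_norm[OF QR] .
  also have "\<dots> \<le> norm x * norm y"
    by (rule Cauchy_Schwarz_ineq2)
  finally have coer: "\<beta> * (norm (R *v x))\<^sup>2 \<le> norm x * norm y" .
  have "\<beta> * (norm x)\<^sup>2 \<le> \<beta> * (?s * norm (R *v x))\<^sup>2"
    using \<open>\<beta> \<ge> 0\<close> by (intro mult_left_mono power_mono norm_le_onorm_matrix_inv inv) auto
  also have "\<dots> = ?s\<^sup>2 * (\<beta> * (norm (R *v x))\<^sup>2)"
    by (simp add: power_mult_distrib)
  also have "\<dots> \<le> ?s\<^sup>2 * (norm x * norm y)"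
    using coer by (intro mult_left_mono) auto
  finally have "norm x * (\<beta> * norm x) \<le> norm x * (?s\<^sup>2 * norm y)"
    by (simp add: power2_eq_square mult_ac)
  then show ?thesis
    unfolding y_def by (cases "x = 0") auto
qed

theorem theorem5p2:
  fixes b :: "'a::{real_inner,complete_space} \<Rightarrow> 'a \<Rightarrow> real"
    and q :: "'n::{finite,linorder} \<Rightarrow> 'a"
    and X\<^sub>h :: "'a set"
    and M \<beta> :: real
  assumes "bilinear b"
    and "M > 0" and "\<And>u v. \<bar>b v u\<bar> \<le> M * norm u * norm v"
    and "\<beta> > 0" and "\<And>u. \<beta> * (norm u)\<^sup>2 \<le> \<bar>b u u\<bar>"
    and "subspace X\<^sub>h" and "dim X\<^sub>h = CARD('n)" and "X\<^sub>h = span (range q)"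
  shows "invertible ((\<chi> i j. b (q j) (q i)) :: real^('n::{finite,linorder})^('n::{finite,linorder})) \<and>
    matrix_cond ((\<chi> i j. b (q j) (q i)) :: real^('n::{finite,linorder})^('n::{finite,linorder})) \<le> M / \<beta> * (quasimatrix_cond q)\<^sup>2"
proof -
  let ?B = "(\<chi> i j. b (q j) (q i)) :: real^('n::{finite,linorder})^('n::{finite,linorder})"
  have basis: "inj q" "independent (range q)"
    using spanning_family_is_basis[of q] assms(7,8) by auto
  obtain Q R where QR: "quasimatrix_QR q Q R"
    using quasimatrix_QR_exists[OF basis] by blast
  have inv: "invertible R"
    by (rule quasimatrix_QR_invertible[OF basis QR])
  define r where "r = onorm ((*v) R)"
  define s where "s = onorm ((*v) (matrix_inv R))"
  have upper: "onorm ((*v) ?B) \<le> M * r\<^sup>2"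
    unfolding r_def using assms(2) by (intro onorm_Galerkin_matrix_le[OF assms(1) _ assms(3) QR]) auto
  have lower: "\<beta> * norm x \<le> s\<^sup>2 * norm (?B *v x)" for x
    unfolding s_def using assms(4) by (intro Galerkin_matrix_lower_bound[OF assms(1) _ assms(5) QR inv]) auto
  \<comment> \<open>The index type is nonempty, so there is a nonzero vector, and \<open>s = 0\<close> would contradict \<open>lower\<close>.\<close>
  have "s \<noteq> 0"
    using lower[of "axis undefined 1"] assms(4) by auto
  then have s: "s\<^sup>2 > 0"
    by simp
  have bdd: "\<beta> / s\<^sup>2 * norm x \<le> norm (?B *v x)" for x
    using lower[of x] s by (simp add: divide_le_eq mult.commute)
  have c: "\<beta> / s\<^sup>2 > 0"
    using assms(4) s by simp
  have "matrix_cond ?B \<le> (M * r\<^sup>2) * (1 / (\<beta> / s\<^sup>2))"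
    unfolding matrix_cond_def
    using upper invertible_if_bounded_below(2)[OF c bdd] assms(2)
    by (intro mult_mono onorm_pos_le matrix_vector_mul_bounded_linear) auto
  also have "\<dots> = M / \<beta> * (r * s)\<^sup>2"
    by (simp add: power_mult_distrib)
  also have "r * s = quasimatrix_cond q"
    unfolding r_def s_def quasimatrix_cond_eq[OF QR] matrix_cond_def ..
  finally show ?thesis
    using invertible_if_bounded_below(1)[OF c bdd] by blast
qed

end
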